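(* There are infinitely many triangular numbers which are quotients of tetrahedral numbers; i.e., there are infinitely many positive integers $z$ (giving infinitely many distinct values $t_z$) such that $t_z = \frac{T_y}{T_x}$ for some positive integers $x, y$.
   Context: $t_n = \frac{n(n+1)}{2}$ is the $n$-th triangular number and $T_n = \frac{n(n+1)(n+2)}{6}$ is the $n$-th tetrahedral number. *)

theory Defs
  imports Complex_Main
begin

text \<open>Both numbers are taken in \<^typ>\<open>rat\<close>, so that every division below,
  including the quotient of two tetrahedral numbers, is exact field division.\<close>

definition triangular :: "nat \<Rightarrow> rat" where
  "triangular n = of_nat (n * (n + 1)) / 2"

definition tetrahedral :: "nat \<Rightarrow> rat" where
  "tetrahedral n = of_nat (n * (n + 1) * (n + 2)) / 6"

end

theory Submission
  imports Defs "HOL-Library.Infinite_Set"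
begin

text \<open>For \<open>y = 3 T\<^sub>x\<close> the factor \<open>y\<close> of \<open>6 T\<^sub>y = y (y + 1) (y + 2)\<close> is cancelled by \<open>T\<^sub>x\<close>,
  and what remains is \<open>T\<^sub>y / T\<^sub>x = (y + 1) (y + 2) / 2 = t\<^bsub>y+1\<^esub>\<close>. Since
  \<open>3 T\<^sub>x = x t\<^bsub>x+1\<^esub>\<close> is always an integer, every positive \<open>x\<close> yields such a quotient.\<close>

lemma triangular_Suc: "triangular (Suc n) = triangular n + of_nat (Suc n)"
  unfolding triangular_def by (simp add: field_simps)

lemma strict_mono_triangular: "strict_mono triangular"
  by (simp add: strict_mono_Suc_iff triangular_Suc)

lemma triangular_eq_of_nat_sum: "triangular n = of_nat (\<Sum>{..n})"
proof (induction n)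
  case 0
  then show ?case by (simp add: triangular_def)
next
  case (Suc n)
  then show ?case by (simp add: triangular_Suc)
qed

lemma tetrahedral_pos:
  assumes "n > 0"
  shows "tetrahedral n > 0"
  unfolding tetrahedral_def using assms by (simp del: of_nat_mult of_nat_add)

lemma three_tetrahedral_eq_mult_triangular:
  "3 * tetrahedral n = of_nat n * triangular (Suc n)"
  unfolding tetrahedral_def triangular_def by (simp add: field_simps)

lemma triangular_Suc_eq_tetrahedral_quotient:
  assumes "x > 0" and "of_nat y = 3 * tetrahedral x"
  shows "triangular (Suc y) = tetrahedral y / tetrahedral x"
proof -
  have "3 * tetrahedral y = 3 * (tetrahedral x * triangular (Suc y))"
    using three_tetrahedral_eq_mult_triangular[of y] assms(2) by simp
  with tetrahedral_pos[OF assms(1)] show ?thesis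
    by (simp add: field_simps)
qed

lemma triangular_tetrahedral_quotientE:
  assumes "x > 0"
  obtains y where "y \<ge> x" and "triangular (Suc y) = tetrahedral y / tetrahedral x"
proof
  define y where "y = x * \<Sum>{..Suc x}"
  show "y \<ge> x" by (simp add: y_def)
  have "of_nat y = 3 * tetrahedral x"
    unfolding y_def three_tetrahedral_eq_mult_triangular triangular_eq_of_nat_sum
    by (rule of_nat_mult)
  with assms show "triangular (Suc y) = tetrahedral y / tetrahedral x"
    by (rule triangular_Suc_eq_tetrahedral_quotient)
qed

theorem theorem5p1:
  "infinite {z :: nat. z > 0 \<and>
      (\<exists>x y :: nat. x > 0 \<and> y > 0 \<and> triangular z = tetrahedral y / tetrahedral x)} \<and>
   infinite {t :: rat. \<exists>z x y :: nat. z > 0 \<and> x > 0 \<and> y > 0 \<and>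
      t = triangular z \<and> t = tetrahedral y / tetrahedral x}"
  (is "infinite ?Z \<and> infinite ?T")
proof
  show infinite_indices: "infinite ?Z"
    unfolding infinite_nat_iff_unbounded
  proof
    fix m :: nat
    obtain y where "y \<ge> Suc m"
      and "triangular (Suc y) = tetrahedral y / tetrahedral (Suc m)"
      by (rule triangular_tetrahedral_quotientE[OF zero_less_Suc])
    moreover from \<open>y \<ge> Suc m\<close> have "Suc m > 0" "y > 0" "Suc y > m" by simp_all
    ultimately show "\<exists>z>m. z \<in> ?Z" by blast
  qed
  have "inj_on triangular ?Z"
    using strict_mono_triangular by (rule strict_mono_imp_inj_on)
  with infinite_indices have "infinite (triangular ` ?Z)"
    by (simp only: finite_image_iff not_False_eq_True)
  moreover have "triangular ` ?Z \<subseteq> ?T" by blast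
  ultimately show "infinite ?T" by (rule infinite_super[rotated])
qed

end
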